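(* Let $\partial D'$ denote the boundary of $D'$ in $\mathbb{R}^2$. Then $$\{(a,b)\in\mathbb{Z}^2\cap\partial D'\mid x^2-ax+b \text{ is irreducible over } \mathbb{Z}\}=\{(1,-1)\}.$$
   Context: $D'=\{(a,b)\in\mathbb{R}^2\mid a\ge1,\ a-1\ge b\ge -a-1\}$. The pair $(a,b)=(1,-1)$ corresponds to the Fibonacci recursion $a_{n+2}=a_{n+1}+a_n$ among the recursions $a_{n+2}-a\,a_{n+1}+b\,a_n=0$. *)

theory Defs
  imports "HOL-Analysis.Analysis" "HOL-Computational_Algebra.Polynomial"
begin

definition D' :: "(real \<times> real) set" where
  "D' = {(a, b). a \<ge> 1 \<and> a - 1 \<ge> b \<and> b \<ge> - a - 1}"

end

theory Submission imports Defs begin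

text \<open>
  The region is a closed polyhedron with edges on the lines \<open>a = 1\<close>, \<open>b = a - 1\<close> and
  \<open>b = - a - 1\<close>. The last two lines say that \<open>x\<^sup>2 - a x + b\<close> vanishes at \<open>1\<close> and at \<open>- 1\<close>
  respectively, so the polynomial is reducible there. The edge on the line \<open>a = 1\<close> joins the other
  two at its end points \<open>(1, 0)\<close> and \<open>(1, - 2)\<close>, which leaves \<open>(1, - 1)\<close> as its only
  integral point off those lines.
  The polynomial \<open>x\<^sup>2 - x - 1\<close> has no integral root, because \<open>x (x - 1)\<close> is always even, and a
  monic quadratic over an integral domain without a root is irreducible
  (\<open>irreducible_monic_quadratic_iff\<close>).
\<close>

text \<open>
  Moving in the direction \<open>(- 1, 0)\<close> decreases the slack of all three inequalities at once, so a
  single direction leaves the region from every point at which one of them is an equality.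
\<close>

lemma frontier_D':
  "frontier D' = {(a, b) \<in> D'. a = 1 \<or> b = a - 1 \<or> b = - a - 1}"
proof -
  let ?S = "{p :: real \<times> real. 1 < fst p \<and> snd p < fst p - 1 \<and> - fst p - 1 < snd p}"
  have eq: "D' = {p. 1 \<le> fst p \<and> snd p \<le> fst p - 1 \<and> - fst p - 1 \<le> snd p}"
    by (auto simp: D'_def)
  have "closed D'"
    unfolding eq by (intro closed_Collect_conj closed_Collect_le continuous_intros)
  moreover have "interior D' = ?S"
  proof (rule interior_unique)
    show "?S \<subseteq> D'"
      by (auto simp: D'_def)
    show "open ?S"
      by (intro open_Collect_conj open_Collect_less continuous_intros)
  next
    fix T :: "(real \<times> real) set"
    assume T: "T \<subseteq> D'" "open T"
    show "T \<subseteq> ?S"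
    proof
      fix p assume "p \<in> T"
      then obtain e where e: "e > 0" "ball p e \<subseteq> T"
        using T openE by blast
      have "(fst p - e / 2, snd p) \<in> ball p e"
        using e by (cases p) (simp add: dist_Pair_Pair dist_real_def)
      then have "(fst p - e / 2, snd p) \<in> D'"
        using e T by blast
      then show "p \<in> ?S"
        using e by (auto simp: D'_def)
    qed
  qed
  ultimately have "frontier D' = D' - ?S"
    by (simp add: frontier_def)
  moreover have "p \<in> D' - ?S \<longleftrightarrow> p \<in> {(a, b) \<in> D'. a = 1 \<or> b = a - 1 \<or> b = - a - 1}" for p
  proof (cases p)
    case (Pair a b)
    show ?thesis
      unfolding Pair D'_def Diff_iff mem_Collect_eq prod.case fst_conv snd_conv by linarith
  qed
  ultimately show ?thesis
    by blast
qed

text \<open>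
  The two factors of a monic polynomial have leading coefficients with product \<open>1\<close>. Hence a
  constant factor is a unit, and a linear factor has a root in the ring itself, not only in its
  field of fractions.
\<close>

lemma irreducible_monic_quadratic_iff:
  fixes b c :: "'a :: idom"
  shows "irreducible [:c, b, 1:] \<longleftrightarrow> (\<forall>x. poly [:c, b, 1:] x \<noteq> 0)"
proof
  assume irr: "irreducible [:c, b, 1:]"
  show "\<forall>x. poly [:c, b, 1:] x \<noteq> 0"
  proof (intro allI notI)
    fix x assume "poly [:c, b, 1:] x = 0"
    then obtain q where q: "[:c, b, 1:] = [:- x, 1:] * q"
      unfolding poly_eq_0_iff_dvd by (elim dvdE)
    then have "q \<noteq> 0"
      by auto
    then have "degree ([:- x, 1:] * q) = 1 + degree q"
      by (subst degree_mult_eq) auto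
    then have "degree q = 1"
      unfolding q[symmetric] by simp
    moreover have "[:- x, 1:] dvd 1 \<or> q dvd 1"
      using irreducibleD[OF irr q] .
    ultimately show False
      by (auto simp: is_unit_poly_iff)
  qed
next
  assume no_root: "\<forall>x. poly [:c, b, 1:] x \<noteq> 0"
  show "irreducible [:c, b, 1:]"
  proof (rule irreducibleI)
    show "[:c, b, 1:] \<noteq> 0"
      by simp
  next
    show "\<not> [:c, b, 1:] dvd 1"
      by (auto simp: is_unit_poly_iff)
  next
    fix p q assume pq: "[:c, b, 1:] = p * q"
    then have nz: "p \<noteq> 0" "q \<noteq> 0"
      by auto
    have lead: "lead_coeff p * lead_coeff q = 1"
      using arg_cong[OF pq, of lead_coeff] by (simp add: lead_coeff_mult)
    have "degree p + degree q = 2"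
      using arg_cong[OF pq, of degree] nz by (simp add: degree_mult_eq)
    then consider "degree p = 0" | "degree q = 0" | "degree p = 1"
      by linarith
    then show "p dvd 1 \<or> q dvd 1"
    proof cases
      case 1
      then obtain d where "p = [:d:]"
        using degree_eq_zeroE by blast
      with lead show ?thesis
        by (auto simp: is_unit_poly_iff intro: dvdI[of 1 d "lead_coeff q"])
    next
      case 2
      then obtain d where "q = [:d:]"
        using degree_eq_zeroE by blast
      with lead show ?thesis
        by (auto simp: is_unit_poly_iff mult.commute intro: dvdI[of 1 d "lead_coeff p"])
    next
      case 3
      \<comment> \<open>The inverse of the leading coefficient of \<open>p\<close> is that of \<open>q\<close>, which gives the root of
        the linear polynomial \<open>p\<close> without division.\<close>
      define x where "x = - coeff p 0 * lead_coeff q"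
      have "poly p x = coeff p 0 * (1 - lead_coeff p * lead_coeff q)"
        by (simp add: poly_altdef 3 x_def algebra_simps)
      then have "poly [:c, b, 1:] x = 0"
        unfolding pq by (simp add: lead)
      with no_root show ?thesis
        by blast
    qed
  qed
qed

theorem mainTheorem8:
  "{(a :: int, b :: int). (real_of_int a, real_of_int b) \<in> frontier D' \<and>
      irreducible [:b, - a, 1:]} = {(1, - 1)}"
proof -
  have "a = 1 \<and> b = - 1"
    if fr: "(real_of_int a, real_of_int b) \<in> frontier D'" and irr: "irreducible [:b, - a, 1:]"
    for a b :: int
  proof -
    have no_root: "poly [:b, - a, 1:] x \<noteq> 0" for x
      using irr unfolding irreducible_monic_quadratic_iff by blast
    have "b \<noteq> a - 1" "b \<noteq> - a - 1"
      using no_root[of 1] no_root[of "- 1"] by auto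
    moreover have "b \<le> a - 1" "- a - 1 \<le> b" "a = 1 \<or> b = a - 1 \<or> b = - a - 1"
      using fr unfolding frontier_D' unfolding D'_def mem_Collect_eq prod.case by linarith+
    ultimately show ?thesis
      by linarith
  qed
  moreover have "(real_of_int 1, real_of_int (- 1)) \<in> frontier D'"
    unfolding frontier_D' by (simp add: D'_def)
  moreover have "irreducible [:- 1, - 1, 1 :: int:]"
    unfolding irreducible_monic_quadratic_iff
  proof (intro allI notI)
    fix x :: int assume "poly [:- 1, - 1, 1:] x = 0"
    then have "x * (x - 1) = 1"
      by (simp add: algebra_simps)
    moreover have "even (x * (x - 1))"
      by simp
    ultimately show False
      by simp
  qed
  ultimately show ?thesis
    by auto
qed

end
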